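(* For every integer $d\ge 1$, the graph of a $d$-cube is strongly $\lfloor d/2\rfloor$-linked.
   Context: A $d$-cube is a polytope combinatorially equivalent to the convex hull in $\mathbb{R}^d$ of the $2^d$ vectors $(\pm1,\ldots,\pm1)$. The graph of a polytope is the undirected graph formed by its vertices and edges; the graph of a $d$-cube is the usual hypercube graph on $2^d$ vertices, in which two vertices are adjacent iff they differ in exactly one coordinate. A graph $G$ is $k$-linked if it has at least $2k$ vertices and, for every set of $2k$ distinct vertices of $G$ and every partition of this set into $k$ pairs $\{s_1,t_1\},\ldots,\{s_k,t_k\}$, there exist $k$ pairwise vertex-disjoint paths $L_1,\ldots,L_k$ in $G$ such that $L_i$ joins $s_i$ and $t_i$ for each $i$. A graph $G$ is strongly $k$-linked if it has at least $2k+1$ vertices and, for every vertex $v$ of $G$, the subgraph $G-v$ (obtained by deleting $v$) is $k$-linked. *)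

theory Defs
  imports "HOL-Analysis.Analysis" "Graph_Theory.Graph_Theory"
begin

section \<open>Cubes and graphs of polytopes\<close>

definition combinatorially_equivalent ::
    "'a::euclidean_space set \<Rightarrow> 'b::euclidean_space set \<Rightarrow> bool" where
  "combinatorially_equivalent P Q \<longleftrightarrow>
    (\<exists>\<phi>. bij_betw \<phi> {F. F face_of P} {F. F face_of Q} \<and>
         (\<forall>F G. F face_of P \<and> G face_of P \<longrightarrow> (F \<subseteq> G \<longleftrightarrow> \<phi> F \<subseteq> \<phi> G)))"

definition standard_cube :: "(real ^ 'd) set" where
  "standard_cube = convex hull {x. \<forall>i. x $ i = 1 \<or> x $ i = - 1}"

text \<open>The dimension of a cube is given by a type: a \<open>d\<close>-cube is a polytope \<open>P\<close>, in a Euclidean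
  space of any dimension, with \<open>is_cube TYPE('d) P\<close> where \<open>CARD('d) = d\<close>.\<close>

definition is_cube :: "'d::finite itself \<Rightarrow> 'a::euclidean_space set \<Rightarrow> bool" where
  "is_cube _ P \<longleftrightarrow>
    polytope P \<and> combinatorially_equivalent P (standard_cube :: (real ^ 'd) set)"

text \<open>Undirected graphs are represented as symmetric digraphs.\<close>

definition polytope_graph :: "'a::euclidean_space set \<Rightarrow> ('a, 'a \<times> 'a) pre_digraph" where
  "polytope_graph P =
    \<lparr>verts = {v. v extreme_point_of P},
     arcs = {(u, v). u extreme_point_of P \<and> v extreme_point_of P \<and> closed_segment u v edge_of P},
     tail = fst, head = snd\<rparr>"

lemma graph_polytope_graph:
  assumes "polytope P"
  shows "graph (polytope_graph P)"
proof -
  have fin: "finite {v. v extreme_point_of P}"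
    using assms by (simp add: finite_polyhedron_extreme_points polytope_imp_polyhedron)
  show ?thesis
  proof (unfold_locales; (simp add: polytope_graph_def fin arc_to_ends_def split: prod.splits; fail)?)
    show "finite (arcs (polytope_graph P))"
      by (rule finite_subset[OF _ finite_cartesian_product[OF fin fin]])
        (auto simp: polytope_graph_def)
    show "tail (polytope_graph P) e \<noteq> head (polytope_graph P) e"
      if "e \<in> arcs (polytope_graph P)" for e
      using that by (auto simp: polytope_graph_def edge_of_def)
    show "symmetric (polytope_graph P)"
      by (auto simp: symmetric_conv polytope_graph_def closed_segment_commute)
  qed
qed

section \<open>Linkedness\<close>

text \<open>The cardinality condition below says that the \<open>2 * k\<close> terminals
  \<open>s\<^sub>0, t\<^sub>0, \<dots>\<close> are pairwise distinct. Graphs are meant to be finite.\<close>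

definition linked :: "nat \<Rightarrow> ('v, 'e) pre_digraph \<Rightarrow> bool" where
  "linked k G \<longleftrightarrow>
    2 * k \<le> card (verts G) \<and>
    (\<forall>s t :: nat \<Rightarrow> 'v.
      s ` {..<k} \<union> t ` {..<k} \<subseteq> verts G \<and> card (s ` {..<k} \<union> t ` {..<k}) = 2 * k \<longrightarrow>
      (\<exists>L :: nat \<Rightarrow> 'v list.
        (\<forall>i<k. vpath (L i) G \<and> hd (L i) = s i \<and> last (L i) = t i) \<and>
        (\<forall>i<k. \<forall>j<k. i \<noteq> j \<longrightarrow> set (L i) \<inter> set (L j) = {})))"

definition strongly_linked :: "nat \<Rightarrow> ('v, 'e) pre_digraph \<Rightarrow> bool" where
  "strongly_linked k G \<longleftrightarrow>
    2 * k + 1 \<le> card (verts G) \<and>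
    (\<forall>v \<in> verts G. linked k (pre_digraph.del_vert G v))"

end

theory Submission
  imports Defs
begin

text \<open>The combinatorial core is that deleting a vertex \<open>v\<close> from the graph of a \<open>d\<close>-cube leaves a graph
  in which any \<open>k\<close> pairs with \<open>2 * k \<le> d\<close> can be linked (\<open>strongly_linkable_finite\<close>). The proof is by
  induction on \<open>d\<close>: along a well-chosen coordinate \<open>i\<close> the terminals are moved into a facet and are
  linked there. Moving is harmless if no two of the moved vertices differ in \<open>i\<close> only. Bondy's
  theorem (\<open>collapsible_coordinate\<close>) supplies such a coordinate for any \<open>d\<close> vertices of the \<open>d\<close>-cube.

  If \<open>2 * k < d\<close>, then \<open>v\<close> and the terminals together are at most \<open>d\<close> vertices, and all pairs can be
  linked inside one facet.

  If \<open>2 * k = d\<close> and \<open>k \<ge> 2\<close> (the square is settled by connectivity), a facet is large enough only for \<open>k - 1\<close> pairs and one forbidden vertex. Choose \<open>i\<close>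
  good for the terminals alone. One pair is routed in one facet, where connectivity of the cube
  suffices, and the other pairs are moved to the opposite facet and are linked there by the induction
  hypothesis (\<open>split_link\<close>). Let \<open>v'\<close> be the neighbour of \<open>v\<close> in direction \<open>i\<close>. The pair to be
  routed separately is found as follows.

  \<^item> All of \<open>v\<close> and the terminals lie in one facet. Then the other terminals and \<open>v\<close> are as many as the
    dimension of the facet, so they can separate two ends only by surrounding one of them
    (\<open>subcube_superconnected\<close>). If every pair had a surrounded end, \<open>v\<close> and two such ends would form
    a triangle, which a cube does not contain (\<open>linkable_within_facet\<close>).

  \<^item> Otherwise a pair in the facet of \<open>v\<close> can be routed there; failing that, so can a pair with one
    end in the facet of \<open>v\<close> and the other end, different from \<open>v'\<close>, in the opposite facet; failing that,
    if all terminals lie opposite to \<open>v\<close>, a pair can be routed in that opposite facet, and it is chosen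
    so that it contains \<open>v'\<close> whenever \<open>v'\<close> is a terminal.

  \<^item> There remains the case that some pair consists of \<open>v'\<close> and a vertex in the facet of \<open>v\<close>, and that
    all other terminals lie in the facet of \<open>v'\<close>. That pair makes a detour around \<open>v\<close> that meets the
    facet of \<open>v'\<close> in a single edge, and a second coordinate, along which this edge runs, is collapsed to
    link the others in a cube of dimension \<open>d - 2\<close> (\<open>linkable_by_detour\<close>).

  For a polytope \<open>P\<close> whose face lattice is that of the standard cube, the lattice isomorphism matches the
  vertices, and an edge of the cube corresponds to a face of \<open>P\<close> with exactly two vertices, hence to
  a segment (\<open>is_cube_vertices\<close>). So the graph of \<open>P\<close> contains the hypercube graph as a spanning
  subgraph, and this is all that linkedness needs.\<close>

section \<open>Faces of the hypercube and walks in sets of vertices\<close>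

text \<open>The vertices of all cubes are Boolean functions on one index type, and a face is given by its set \<open>I\<close>
  of free coordinates and by the values \<open>b\<close> of the others. Facets of faces are of the same form, so
  the induction on the dimension needs no isomorphisms.\<close>
definition subcube :: "'d set \<Rightarrow> ('d \<Rightarrow> bool) \<Rightarrow> ('d \<Rightarrow> bool) set" where
  "subcube I b = {x. \<forall>i. i \<notin> I \<longrightarrow> x i = b i}"

lemma subcube_facet:
  assumes "i \<in> I"
  shows "subcube (I - {i}) (b(i := c)) = {x \<in> subcube I b. x i = c}"
  using assms by (auto simp: subcube_def)

lemma upd_in_subcube: "x \<in> subcube I b \<Longrightarrow> i \<in> I \<Longrightarrow> x(i := c) \<in> subcube I b"
  by (auto simp: subcube_def)

lemma card_subcube:
  assumes "finite I"
  shows "finite (subcube I b) \<and> card (subcube I b) = 2 ^ card I"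
  using assms
proof (induction I arbitrary: b)
  case empty
  have "subcube {} b = {b}"
    by (auto simp: subcube_def)
  then show ?case
    by simp
next
  case (insert i I)
  have un: "subcube (insert i I) b = subcube I (b(i := True)) \<union> subcube I (b(i := False))"
    using subcube_facet[of i "insert i I" b True] subcube_facet[of i "insert i I" b False] insert.hyps
    by auto
  have "subcube I (b(i := True)) \<inter> subcube I (b(i := False)) = {}"
    using insert.hyps by (auto simp: subcube_def)
  then show ?case
    using insert unfolding un by (simp add: card_Un_disjoint)
qed

lemma upd_eq_cases: "x(i := c) = x \<or> x(i := c) = x(i := \<not> x i)" for x :: "'d \<Rightarrow> bool"
  by (cases "c = x i") auto

text \<open>Taking \<open>c = x i\<close> in a step means standing still. This lets one step bring a vertex into a
  facet, whether or not it is already there.\<close>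
inductive joined :: "('d \<Rightarrow> bool) set \<Rightarrow> ('d \<Rightarrow> bool) \<Rightarrow> ('d \<Rightarrow> bool) \<Rightarrow> bool" for W where
  stay: "x \<in> W \<Longrightarrow> joined W x x"
| move: "x \<in> W \<Longrightarrow> joined W (x(i := c)) y \<Longrightarrow> joined W x y"

lemma joined_in: "joined W x y \<Longrightarrow> x \<in> W \<and> y \<in> W"
  by (induction rule: joined.induct) auto

lemma joined_mono: "joined W x y \<Longrightarrow> W \<subseteq> V \<Longrightarrow> joined V x y"
  by (induction rule: joined.induct) (auto intro: joined.intros)

lemma joined_trans: "joined W x y \<Longrightarrow> joined W y z \<Longrightarrow> joined W x z"
  by (induction rule: joined.induct) (auto intro: joined.intros)

lemma joined_upd: "x \<in> W \<Longrightarrow> x(i := c) \<in> W \<Longrightarrow> joined W x (x(i := c))"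
  by (auto intro: joined.intros)

lemma joined_upd_back: "x \<in> W \<Longrightarrow> x(i := c) \<in> W \<Longrightarrow> joined W (x(i := c)) x"
  using joined_upd[of "x(i := c)" W i "x i"] by simp

lemma joined_sym: "joined W x y \<Longrightarrow> joined W y x"
proof (induction rule: joined.induct)
  case (move x i c y)
  then have "joined W (x(i := c)) x"
    using joined_in joined_upd_back by metis
  then show ?case
    using move.IH joined_trans by metis
qed (rule joined.stay)

section \<open>Coordinates that can be collapsed\<close>

text \<open>Add the vertices one by one. Since the coordinates chosen so far distinguish the old vertices, the
  new vertex agrees with at most one of them there, and one further coordinate separates these two.\<close>
lemma separating_coordinates:
  assumes "finite Y" "Y \<noteq> {}"
  shows "\<exists>S. finite S \<and> card S < card Y \<and> (\<forall>x\<in>Y. \<forall>y\<in>Y. (\<forall>i\<in>S. x i = y i) \<longrightarrow> x = (y :: 'd \<Rightarrow> bool))"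
  using assms
proof (induction Y rule: finite_ne_induct)
  case (singleton x)
  then show ?case
    by (intro exI[of _ "{}"]) auto
next
  case (insert z Y)
  then obtain S where S: "finite S" "card S < card Y"
    and sep: "\<And>x y. x \<in> Y \<Longrightarrow> y \<in> Y \<Longrightarrow> (\<forall>i\<in>S. x i = y i) \<Longrightarrow> x = y"
    by blast
  show ?case
  proof (cases "\<exists>y\<in>Y. \<forall>i\<in>S. y i = z i")
    case True
    then obtain y where y: "y \<in> Y" "\<forall>i\<in>S. y i = z i"
      by blast
    then have "y \<noteq> z"
      using insert.hyps by blast
    then obtain l where l: "y l \<noteq> z l"
      by blast
    have uniq: "x = y" if "x \<in> Y" "\<forall>i\<in>S. x i = z i" for x
      using sep[of x y] that y by simp
    have "card (insert l S) < card (insert z Y)"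
      using S insert.hyps by (simp add: card_insert_if)
    moreover have "x = x'" if "x \<in> insert z Y" "x' \<in> insert z Y" "\<forall>i\<in>insert l S. x i = x' i" for x x'
      using that sep uniq l by (metis insert_iff)
    ultimately show ?thesis
      using S(1) by (intro exI[of _ "insert l S"]) blast
  next
    case False
    then have "x = x'" if "x \<in> insert z Y" "x' \<in> insert z Y" "\<forall>i\<in>S. x i = x' i" for x x'
      using that sep by (metis insert_iff)
    moreover have "card S < card (insert z Y)"
      using S insert.hyps by simp
    ultimately show ?thesis
      using S(1) by blast
  qed
qed

text \<open>Bondy's theorem: any coordinate outside a separating set of fewer than \<open>card Y\<close> coordinates will do.
  It will be applied both to all coordinates and to all but one of them.\<close>
lemma collapsible_coordinate:
  assumes "finite Y" "card Y \<le> card K" "0 < card K"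
  obtains i where "i \<in> K" "\<And>c. inj_on (\<lambda>x :: 'd \<Rightarrow> bool. x(i := c)) Y"
proof (cases "Y = {}")
  case True
  then show ?thesis
    using that assms(3) by (metis card_gt_0_iff ex_in_conv inj_on_empty)
next
  case False
  then obtain S where S: "finite S" "card S < card Y"
    and sep: "\<And>x y. x \<in> Y \<Longrightarrow> y \<in> Y \<Longrightarrow> (\<forall>i\<in>S. x i = y i) \<Longrightarrow> x = y"
    using separating_coordinates[OF assms(1)] by blast
  have "\<not> K \<subseteq> S"
    using assms(2) S(2) card_mono[OF S(1), of K] by linarith
  then obtain i where i: "i \<in> K" "i \<notin> S"
    by blast
  have "inj_on (\<lambda>x. x(i := c)) Y" for c
    using sep i(2) by (intro inj_onI) (metis fun_upd_other)
  then show ?thesis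
    using that i(1) by blast
qed

section \<open>Connectivity of cubes\<close>

text \<open>There are \<open>2 ^ (card I - 1)\<close> edges in direction \<open>i\<close>, and they are disjoint, so \<open>R\<close> cannot meet
  each of them.\<close>
lemma crossing_edge:
  assumes "finite I" "i \<in> I" "finite R" "card R < 2 ^ (card I - 1)"
  obtains x where "x \<in> subcube I b" "x i = c" "x \<notin> R" "x(i := \<not> c) \<notin> R"
proof -
  let ?F = "subcube (I - {i}) (b(i := c))"
  have "card ((\<lambda>x. x(i := c)) ` R) < card ?F"
    using card_image_le[OF assms(3), of "\<lambda>x. x(i := c)"] assms card_subcube[of "I - {i}"] by auto
  then have "\<not> ?F \<subseteq> (\<lambda>x. x(i := c)) ` R"
    using assms(3) by (meson card_mono finite_imageI leD)
  then obtain x where x: "x \<in> ?F" "x \<notin> (\<lambda>x. x(i := c)) ` R"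
    by blast
  then have "x(i := c) = x"
    using subcube_facet[OF assms(2)] by fastforce
  then have "x \<notin> R" "x(i := \<not> c) \<notin> R"
    using x(2) by (metis imageI, metis fun_upd_upd imageI)
  then show ?thesis
    using that x(1) subcube_facet[OF assms(2)] by blast
qed

lemma joined_across:
  assumes "finite I" "i \<in> I" "finite R" "card R < 2 ^ (card I - 1)"
    and con: "\<And>c x y. x \<in> {z \<in> subcube I b. z i = c} - R \<Longrightarrow> y \<in> {z \<in> subcube I b. z i = c} - R
      \<Longrightarrow> joined (subcube I b - R) x y"
    and "x \<in> subcube I b - R" "y \<in> subcube I b - R"
  shows "joined (subcube I b - R) x y"
proof (cases "x i = y i")
  case True
  then show ?thesis
    using con[of x "x i" y] assms by auto
next
  case False
  obtain z where z: "z \<in> subcube I b" "z i = x i" "z \<notin> R" "z(i := \<not> x i) \<notin> R"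
    using crossing_edge[OF assms(1-4)] .
  let ?z = "z(i := \<not> x i)"
  have z': "?z \<in> subcube I b"
    using z(1) assms(2) by (rule upd_in_subcube)
  have "joined (subcube I b - R) x z"
    using con[of x "x i" z] z assms by auto
  moreover have "joined (subcube I b - R) z ?z"
    using z z' by (intro joined_upd) auto
  moreover have "joined (subcube I b - R) ?z y"
    using con[of ?z "y i" y] z z' assms False by auto
  ultimately show ?thesis
    using joined_trans by metis
qed

lemma card_Int_less_of_mem:
  assumes "finite R" "r \<in> R" "r \<notin> A"
  shows "card (R \<inter> A) < card R"
  using assms by (intro psubset_card_mono) auto

text \<open>Cut the cube between \<open>x\<close> and \<open>y\<close>. If \<open>R\<close> misses one of the two facets, then the end in
  the other facet can simply cross over. If \<open>R\<close> meets both, each facet contains fewer elements of \<open>R\<close>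
  than \<open>R\<close> has, so both facets stay connected, and some edge between them survives.\<close>
lemma subcube_connected:
  assumes "finite I" "finite R" "card R \<le> card I - 1"
    and "x \<in> subcube I b - R" "y \<in> subcube I b - R"
  shows "joined (subcube I b - R) x y"
  using assms
proof (induction "card I" arbitrary: I b R x y rule: less_induct)
  case less
  let ?C = "subcube I b"
  show ?case
  proof (cases "x = y")
    case True
    then show ?thesis
      using less.prems joined.stay by metis
  next
    case False
    then obtain i where i: "x i \<noteq> y i"
      by blast
    then have iI: "i \<in> I"
      using less.prems by (auto simp: subcube_def)
    have smaller: "card (I - {i}) < card I"
      using iI less.prems(1) by (rule card_Diff1_less[rotated])
    have facet: "joined (?C - R) u w"
      if "card (R \<inter> {z. z i = c}) \<le> card I - 2" "u \<in> {z \<in> ?C. z i = c} - R" "w \<in> {z \<in> ?C. z i = c} - R"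
      for c u w
    proof -
      have "joined (subcube (I - {i}) (b(i := c)) - R \<inter> {z. z i = c}) u w"
        using that less.prems iI by (intro less.hyps[OF smaller]) (auto simp: subcube_facet)
      then show ?thesis
        by (rule joined_mono) (auto simp: subcube_facet[OF iI])
    qed
    \<comment> \<open>The end \<open>w\<close> lies in a facet free of \<open>R\<close>, and \<open>u\<close> crosses over to it.\<close>
    consider (other) u w where "{u, w} = {x, y}" "R \<inter> {z. z i = w i} = {}"
      | (both) r r' where "r \<in> R" "r i = x i" "r' \<in> R" "r' i = y i"
    proof (cases "R \<inter> {z. z i = x i} = {} \<or> R \<inter> {z. z i = y i} = {}")
      case True
      then show ?thesis
        using other[of x y] other[of y x] by (auto simp: insert_commute)
    next
      case False
      then show ?thesis
        using both by auto
    qed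
    then show ?thesis
    proof cases
      case other
      let ?u = "u(i := w i)"
      have uw: "u \<in> ?C - R" "w \<in> ?C - R"
        using other(1) less.prems by (auto simp: doubleton_eq_iff)
      have u': "?u \<in> ?C - R"
        using uw upd_in_subcube[OF _ iI] other(2) by fastforce
      have "joined (?C - R) u ?u"
        using uw u' by (intro joined_upd)
      moreover have "joined (?C - R) ?u w"
        using facet[of "w i" ?u w] other(2) uw u' by simp
      ultimately show ?thesis
        using other(1) joined_trans joined_sym by (metis doubleton_eq_iff)
    next
      case both
      have "card (R \<inter> {z. z i = c}) \<le> card I - 2" for c
      proof -
        have "\<exists>r\<in>R. r i \<noteq> c"
          using both i by metis
        then have "card (R \<inter> {z. z i = c}) < card R"
          using less.prems(2) by (auto intro: card_Int_less_of_mem)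
        then show ?thesis
          using less.prems(3) by linarith
      qed
      note halves = facet[OF this]
      have "card R < 2 ^ (card I - 1)"
        using less.prems(3) less_exp[of "card I - 1"] by linarith
      from joined_across[OF less.prems(1) iI less.prems(2) this halves less.prems(4,5)]
      show ?thesis .
    qed
  qed
qed

lemma less_two_power_pred:
  assumes "3 \<le> n"
  shows "n < 2 ^ (n - 1)"
  using assms
proof (induction n rule: nat_induct_at_least)
  case (Suc n)
  then show ?case
    by (cases n) auto
qed simp

text \<open>With one more vertex removed, the only way to separate two vertices is to remove all neighbours of
  one of them. Cut again between \<open>x\<close> and \<open>y\<close>. If one facet contains so much of \<open>R\<close> that it may fall
  apart, then at most one element of \<open>R\<close> lies in the other facet. Should this element block the
  crossing at the end in the crowded facet, then a free neighbour of this end crosses instead.\<close>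
lemma subcube_superconnected:
  assumes "finite I" "3 \<le> card I" "finite R" "card R \<le> card I"
    and xy: "x \<in> subcube I b - R" "y \<in> subcube I b - R"
    and free: "\<exists>l\<in>I. x(l := \<not> x l) \<notin> R" "\<exists>l\<in>I. y(l := \<not> y l) \<notin> R"
  shows "joined (subcube I b - R) x y"
proof (cases "x = y")
  case True
  then show ?thesis
    using xy joined.stay by metis
next
  case False
  let ?C = "subcube I b"
  obtain i where i: "x i \<noteq> y i"
    using False by blast
  then have iI: "i \<in> I"
    using xy by (auto simp: subcube_def)
  have facet: "joined (?C - R) u w"
    if "card (R \<inter> {z. z i = c}) \<le> card I - 2" "u \<in> {z \<in> ?C. z i = c} - R" "w \<in> {z \<in> ?C. z i = c} - R"
    for c u w
  proof -
    have "joined (subcube (I - {i}) (b(i := c)) - R \<inter> {z. z i = c}) u w"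
      using that assms iI by (intro subcube_connected) (auto simp: subcube_facet card_Diff_singleton)
    then show ?thesis
      by (rule joined_mono) (auto simp: subcube_facet[OF iI])
  qed
  \<comment> \<open>The facet of \<open>u\<close> is the crowded one.\<close>
  have large: "joined (?C - R) u w"
    if uw: "{u, w} = {x, y}" and big: "card I - 2 < card (R \<inter> {z. z i = u i})" for u w
  proof -
    have u: "u \<in> ?C - R" and w: "w \<in> ?C - R" and ui: "u i \<noteq> w i"
      and "\<exists>l\<in>I. u(l := \<not> u l) \<notin> R"
      using uw xy i free by (auto simp: doubleton_eq_iff)
    then obtain l where l: "l \<in> I" "u(l := \<not> u l) \<notin> R"
      by blast
    have "card (R \<inter> {z. z i = u i}) + card (R \<inter> {z. z i = w i}) = card R"
      using ui assms(3) by (subst card_Un_disjoint[symmetric]) (auto intro!: arg_cong[of _ _ card])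
    then have one: "card (R \<inter> {z. z i = w i}) \<le> 1"
      using big assms(2,4) by linarith
    note half = facet[of "w i", OF order_trans[OF one]]
    show ?thesis
    proof (cases "u(i := w i) \<in> R")
      case False
      let ?u = "u(i := w i)"
      have u': "?u \<in> ?C - R"
        using u upd_in_subcube[OF _ iI] False by blast
      have "joined (?C - R) u ?u"
        using u u' by (intro joined_upd)
      moreover have "joined (?C - R) ?u w"
        using half[of ?u w] w u' assms(2) by simp
      ultimately show ?thesis
        by (rule joined_trans)
    next
      case True
      let ?p = "u(l := \<not> u l)" and ?q = "(u(l := \<not> u l))(i := w i)"
      have li: "l \<noteq> i"
        using True l(2) ui by (cases "w i") auto
      have p: "?p \<in> ?C - R"
        using u l upd_in_subcube by fast
      have "?q \<noteq> u(i := w i)"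
        using li by (metis fun_upd_other fun_upd_same)
      then have "?q \<notin> R"
        using one True assms(3) card_le_Suc0_iff_eq[of "R \<inter> {z. z i = w i}"] by auto
      then have q: "?q \<in> ?C - R"
        using p upd_in_subcube[OF _ iI] by blast
      have "joined (?C - R) u ?p"
        using u p by (intro joined_upd)
      moreover have "joined (?C - R) ?p ?q"
        using p q by (intro joined_upd)
      moreover have "joined (?C - R) ?q w"
        using half[of ?q w] w q assms(2) by simp
      ultimately show ?thesis
        using joined_trans by metis
    qed
  qed
  show ?thesis
  proof (cases "\<forall>c. card (R \<inter> {z. z i = c}) \<le> card I - 2")
    case True
    have "card I < 2 ^ (card I - 1)"
      using assms(2)
    by (rule less_two_power_pred)
    then have "card R < 2 ^ (card I - 1)"
      using assms(4) by linarith
    from joined_across[OF assms(1) iI assms(3) this facet[OF True[rule_format]] xy]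
    show ?thesis .
  next
    case False
    then obtain c where "card I - 2 < card (R \<inter> {z. z i = c})"
      by (meson leI)
    moreover have "c = x i \<or> c = y i"
      using i by blast
    ultimately consider "card I - 2 < card (R \<inter> {z. z i = x i})" | "card I - 2 < card (R \<inter> {z. z i = y i})"
      by blast
    then show ?thesis
    proof cases
      case 1
      then show ?thesis
        by (rule large[OF refl])
    next
      case 2
      show ?thesis
        using large[of y x, OF insert_commute 2] by (rule joined_sym)
    qed
  qed
qed

section \<open>Linkages\<close>

text \<open>Pair \<open>j\<close> consists of \<open>e (j, False)\<close> and \<open>e (j, True)\<close>; a single function for all terminals makes
  their distinctness a matter of injectivity and treats the two ends alike. Disjoint
  sets in which the pairs are joined stand in for disjoint paths: they can be enlarged by single
  vertices freely.\<close>
definition linkable :: "('d \<Rightarrow> bool) set \<Rightarrow> nat set \<Rightarrow> (nat \<times> bool \<Rightarrow> 'd \<Rightarrow> bool) \<Rightarrow> bool" where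
  "linkable A J e \<longleftrightarrow> (\<exists>W. (\<forall>j\<in>J. W j \<subseteq> A \<and> joined (W j) (e (j, False)) (e (j, True))) \<and>
    disjoint_family_on W J)"

abbreviation terminals :: "nat set \<Rightarrow> (nat \<times> bool \<Rightarrow> 'd \<Rightarrow> bool) \<Rightarrow> ('d \<Rightarrow> bool) set" where
  "terminals J e \<equiv> e ` (J \<times> UNIV)"

lemma linkable_mono: "linkable A J e \<Longrightarrow> A \<subseteq> B \<Longrightarrow> linkable B J e"
  unfolding linkable_def by (meson subset_trans)

lemma joined_both_orders:
  assumes "joined W (e (j, q)) (e (j, \<not> q))"
  shows "joined W (e (j, False)) (e (j, True))"
  using assms joined_sym by (cases q) auto

lemma joined_of_moved_ends:
  assumes "joined W (x(i := c)) (y(i := c))" "x \<in> W" "y \<in> W"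
  shows "joined W x y"
proof (rule joined.move[OF assms(2)])
  have "joined W (y(i := c)) y"
    using joined_in[OF assms(1)] assms(3) by (intro joined_upd_back) auto
  with assms(1) show "joined W (x(i := c)) y"
    by (rule joined_trans)
qed

lemma linkable_add_pair:
  assumes "linkable A (J - {j}) e" "joined B (e (j, False)) (e (j, True))" "A \<inter> B = {}"
  shows "linkable (A \<union> B) J e"
proof -
  obtain W where W: "\<And>j'. j' \<in> J - {j} \<Longrightarrow> W j' \<subseteq> A \<and> joined (W j') (e (j', False)) (e (j', True))"
    and dis: "disjoint_family_on W (J - {j})"
    using assms(1) unfolding linkable_def by blast
  let ?W = "W(j := B)"
  have "?W j' \<subseteq> A \<union> B \<and> joined (?W j') (e (j', False)) (e (j', True))" if "j' \<in> J" for j'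
    using W[of j'] assms(2) that by auto
  moreover have "disjoint_family_on ?W J"
    using dis W assms(3) unfolding disjoint_family_on_def by (simp add: Int_commute) blast
  ultimately show ?thesis
    unfolding linkable_def by blast
qed

text \<open>Each terminal outside the facet reaches it by one edge, and distinct terminals remain distinct there
  because the linkage in the facet is disjoint.\<close>
lemma linkable_of_collapse:
  assumes "linkable A J (\<lambda>q. (e q)(i := c))" and A: "A \<subseteq> {x. x i = c}"
    and inj: "inj_on e (J \<times> UNIV)"
  shows "linkable (A \<union> terminals J e) J e"
proof -
  obtain W where W: "\<And>j. j \<in> J \<Longrightarrow> W j \<subseteq> A"
    and jn: "\<And>j. j \<in> J \<Longrightarrow> joined (W j) ((e (j, False))(i := c)) ((e (j, True))(i := c))"
    and dis: "disjoint_family_on W J"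
    using assms(1) unfolding linkable_def by blast
  let ?W = "\<lambda>j. W j \<union> {e (j, False), e (j, True)}"
  have "joined (?W j) (e (j, False)) (e (j, True))" if "j \<in> J" for j
    by (rule joined_of_moved_ends[of _ _ i c], rule joined_mono[OF jn[OF that]]) auto
  moreover have "disjoint_family_on ?W J"
  proof -
    have foreign: "e (j, q) \<notin> W j'" if "j \<in> J" "j' \<in> J" "j \<noteq> j'" for j j' q
    proof
      assume mem: "e (j, q) \<in> W j'"
      then have "(e (j, q))(i := c) = e (j, q)"
        using W[OF that(2)] A by fastforce
      then have "e (j, q) \<in> W j"
        using joined_in[OF jn[OF that(1)]] by (cases q) auto
      then show False
        using mem dis that unfolding disjoint_family_on_def by blast
    qed
    have "e (j, q) \<noteq> e (j', q')" if "j \<in> J" "j' \<in> J" "j \<noteq> j'" for j j' q q'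
      using inj_onD[OF inj, of "(j, q)" "(j', q')"] that by auto
    then show ?thesis
      using dis foreign unfolding disjoint_family_on_def by simp
  qed
  moreover have "?W j \<subseteq> A \<union> terminals J e" if "j \<in> J" for j
    using W[OF that] that by auto
  ultimately show ?thesis
    unfolding linkable_def by (intro exI[of _ ?W]) blast
qed

text \<open>The vertex \<open>v\<close> may lie outside the cube. Then nothing is deleted, and this form is convenient when
  a facet contains no forbidden vertex.\<close>
definition strongly_linkable :: "'d set \<Rightarrow> bool" where
  "strongly_linkable I \<longleftrightarrow> (\<forall>b J e v. finite J \<and> 2 * card J \<le> card I \<and> inj_on e (J \<times> UNIV) \<and>
     terminals J e \<subseteq> subcube I b - {v} \<longrightarrow> linkable (subcube I b - {v}) J e)"

lemma card_terminals: "inj_on e (J \<times> UNIV) \<Longrightarrow> card (terminals J e) = 2 * card J"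
  by (simp add: card_image card_cartesian_product)

lemma linkable_facet:
  assumes fac: "strongly_linkable (I - {i})" and iI: "i \<in> I"
    and J: "finite J" "2 * card J \<le> card I - 1"
    and inj: "inj_on e (J \<times> UNIV)" "inj_on (\<lambda>x. x(i := c)) (terminals J e)"
    and sub: "terminals J e \<subseteq> subcube I b"
    and w: "w \<notin> (\<lambda>x. x(i := c)) ` terminals J e"
  shows "linkable (({x \<in> subcube I b. x i = c} - {w}) \<union> terminals J e) J e"
proof -
  have "terminals J (\<lambda>q. (e q)(i := c)) \<subseteq> subcube (I - {i}) (b(i := c)) - {w}"
  proof -
    have "(e q)(i := c) \<in> subcube I b" if "q \<in> J \<times> UNIV" for q
      using sub that iI by (intro upd_in_subcube) auto
    then show ?thesis
      using w unfolding subcube_facet[OF iI] by auto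
  qed
  moreover have "inj_on (\<lambda>q. (e q)(i := c)) (J \<times> UNIV)"
    using comp_inj_on[OF inj] by (simp add: comp_def)
  ultimately have "linkable (subcube (I - {i}) (b(i := c)) - {w}) J (\<lambda>q. (e q)(i := c))"
    using fac J iI unfolding strongly_linkable_def by (simp add: card_Diff_singleton)
  then have "linkable ((subcube (I - {i}) (b(i := c)) - {w}) \<union> terminals J e) J e"
    using inj(1) by (intro linkable_of_collapse[where i = i and c = c]) (auto simp: subcube_facet[OF iI])
  then show ?thesis
    by (simp add: subcube_facet[OF iI])
qed

text \<open>Pair \<open>j\<close> is routed in the facet \<open>x i = c\<close>, and the other pairs are linked in the opposite facet. Of
  the deleted vertex \<open>v\<close> and the ends of pair \<open>j\<close> only one, \<open>w\<close>, may lie in that facet, because the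
  induction hypothesis lets the others avoid one vertex there.\<close>
lemma split_link:
  assumes fac: "strongly_linkable (I - {i})" and iI: "i \<in> I"
    and J: "finite J" "j \<in> J" "2 * card J \<le> card I + 1"
    and inj: "inj_on e (J \<times> UNIV)" and sub: "terminals J e \<subseteq> subcube I b - {v}"
    and others: "inj_on (\<lambda>x. x(i := \<not> c)) (terminals (J - {j}) e)"
    and w: "\<And>x. x \<in> {v, e (j, False), e (j, True)} \<Longrightarrow> x i \<noteq> c \<Longrightarrow> x = w"
    and w': "w \<notin> (\<lambda>x. x(i := \<not> c)) ` terminals (J - {j}) e"
    and link: "joined ({x \<in> subcube I b. x i = c} - (terminals (J - {j}) e \<union> {v}))
      ((e (j, False))(i := c)) ((e (j, True))(i := c))"
  shows "linkable (subcube I b - {v}) J e"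
proof -
  let ?O = "terminals (J - {j}) e"
  let ?A = "({x \<in> subcube I b. x i = (\<not> c)} - {w}) \<union> ?O"
  let ?B = "({x \<in> subcube I b. x i = c} - (?O \<union> {v})) \<union> {e (j, False), e (j, True)}"
  have "linkable ?A (J - {j}) e"
  proof (rule linkable_facet[OF fac iI])
    show "2 * card (J - {j}) \<le> card I - 1"
      using J by (simp add: card_Diff_singleton)
    show "inj_on e ((J - {j}) \<times> UNIV)"
      using inj by (rule inj_on_subset) auto
  qed (use J others w' sub in auto)
  moreover have "joined ?B (e (j, False)) (e (j, True))"
    by (rule joined_of_moved_ends[of _ _ i c], rule joined_mono[OF link]) auto
  moreover have "?A \<inter> ?B = {}"
  proof -
    have "e (j, q) \<notin> ?O" for q
      using inj J(2) by (auto dest!: inj_onD)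
    then show ?thesis
      using w by auto
  qed
  ultimately have "linkable (?A \<union> ?B) J e"
    by (rule linkable_add_pair)
  moreover have "?A \<union> ?B \<subseteq> subcube I b - {v}"
    using sub w[of v] J(2) by auto
  ultimately show ?thesis
    by (rule linkable_mono)
qed

text \<open>The other terminals and \<open>v\<close> are \<open>card I - 1\<close> vertices. As soon as one of them is outside the facet
  \<open>x i = c\<close>, those inside are too few to disconnect it.\<close>
lemma split_link_connected:
  assumes fin: "finite I" and fac: "strongly_linkable (I - {i})" and iI: "i \<in> I"
    and J: "finite J" "j \<in> J" "2 * card J = card I"
    and inj: "inj_on e (J \<times> UNIV)" and sub: "terminals J e \<subseteq> subcube I b - {v}"
    and others: "inj_on (\<lambda>x. x(i := \<not> c)) (terminals (J - {j}) e)"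
    and w: "\<And>x. x \<in> {v, e (j, False), e (j, True)} \<Longrightarrow> x i \<noteq> c \<Longrightarrow> x = w"
    and w': "w \<notin> (\<lambda>x. x(i := \<not> c)) ` terminals (J - {j}) e"
    and free: "\<And>q. (e (j, q))(i := c) \<notin> terminals (J - {j}) e \<union> {v}"
    and away: "\<exists>x \<in> terminals (J - {j}) e \<union> {v}. x i \<noteq> c"
  shows "linkable (subcube I b - {v}) J e"
proof (rule split_link[OF fac iI J(1,2) _ inj sub others w w'])
  let ?R = "terminals (J - {j}) e \<union> {v}"
  have finR: "finite ?R"
    using J(1) by simp
  have "card ?R \<le> card I - 1"
  proof -
    have "card (terminals (J - {j}) e) \<le> card ((J - {j}) \<times> (UNIV :: bool set))"
      using J(1) by (intro card_image_le) auto
    also have "\<dots> = card I - 2"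
      using J by (simp add: card_cartesian_product card_Diff_singleton)
    finally have "card (terminals (J - {j}) e) \<le> card I - 2" .
    moreover have "0 < card J"
      using J(1,2) by (auto simp: card_gt_0_iff)
    ultimately show ?thesis
      using J card_Un_le[of "terminals (J - {j}) e" "{v}"] by simp
  qed
  moreover obtain x where "x \<in> ?R" "x \<notin> {z. z i = c}"
    using away by blast
  then have "card (?R \<inter> {z. z i = c}) < card ?R"
    using finR by (rule card_Int_less_of_mem[rotated])
  ultimately have few: "card (?R \<inter> {z. z i = c}) \<le> card (I - {i}) - 1"
    using iI by (simp add: card_Diff_singleton)
  have in_facet: "(e (j, q))(i := c) \<in> subcube (I - {i}) (b(i := c)) - ?R \<inter> {z. z i = c}" for q
  proof -
    have "e (j, q) \<in> subcube I b"
      using sub J(2) by blast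
    then show ?thesis
      using free[of q] upd_in_subcube[OF _ iI] by (simp add: subcube_facet[OF iI])
  qed
  have "joined (subcube (I - {i}) (b(i := c)) - ?R \<inter> {z. z i = c})
      ((e (j, False))(i := c)) ((e (j, True))(i := c))"
    using fin finR few in_facet in_facet by (intro subcube_connected) auto
  then show "joined ({x \<in> subcube I b. x i = c} - ?R) ((e (j, False))(i := c)) ((e (j, True))(i := c))"
    by (rule joined_mono) (auto simp: subcube_facet[OF iI])
qed (use J(3) in auto)

section \<open>Linking as many pairs as half the dimension\<close>

lemma eq_flip:
  fixes x y :: "'d \<Rightarrow> bool"
  assumes "x(i := y i) = y" "x i \<noteq> y i"
  shows "x = y(i := \<not> y i)"
proof
  fix k
  show "x k = (y(i := \<not> y i)) k"
    using assms(2) fun_cong[OF assms(1), of k] by (cases "k = i") auto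
qed

lemma in_terminalsE:
  assumes "x \<in> terminals J e"
  obtains j q where "j \<in> J" "x = e (j, q)"
  using assms by auto

lemma card_other_terminals:
  assumes "finite J" "j \<in> J"
  shows "card (insert v (terminals (J - {j}) e)) \<le> 2 * card J - 1"
proof -
  have "card (terminals (J - {j}) e) \<le> card ((J - {j}) \<times> (UNIV :: bool set))"
    using assms by (intro card_image_le) auto
  also have "\<dots> = 2 * card J - 2"
    using assms by (simp add: card_cartesian_product card_Diff_singleton)
  finally show ?thesis
    using assms card_gt_0_iff[of J] card_insert_le_m1[of "2 * card J - 1" "terminals (J - {j}) e" v] by force
qed

text \<open>There are no triangles: two neighbours of \<open>x\<close> are equal or differ in two coordinates.\<close>
lemma flip_common_neighbour:
  fixes x :: "'d \<Rightarrow> bool"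
  assumes "z = x(m := \<not> x m)" "y = x(l := \<not> x l)"
  shows "z \<noteq> y(p := \<not> y p)"
proof
  assume eq: "z = y(p := \<not> y p)"
  show False
  proof (cases "l = m")
    case True
    then show False
      using assms fun_cong[OF eq, of p] by simp
  next
    case False
    have "p = l" 
      using assms fun_cong[OF eq, of l] False by (auto split: if_splits)
    moreover have "p = m"
      using assms fun_cong[OF eq, of m] False by (auto split: if_splits)
    ultimately show False
      using False by simp
  qed
qed

text \<open>Suppose each pair has an end whose \<open>card K\<close> neighbours are all among \<open>v\<close> and the terminals of other
  pairs. There are only \<open>card K\<close> of the latter, so all of them are neighbours of that end. For two
  pairs, the two ends and \<open>v\<close> are then mutually adjacent.\<close>
lemma unsurrounded_pair:
  assumes "finite K" "finite J" "2 \<le> card J" "2 * card J \<le> card K + 1"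
    and inj: "inj_on e (J \<times> UNIV)"
  shows "\<exists>j\<in>J. \<forall>q. \<exists>l\<in>K. (e (j, q))(l := \<not> e (j, q) l) \<notin> insert v (terminals (J - {j}) e)"
proof (rule ccontr)
  assume "\<not> ?thesis"
  then have sur: "\<exists>q. \<forall>l\<in>K. (e (j, q))(l := \<not> e (j, q) l) \<in> insert v (terminals (J - {j}) e)"
    if "j \<in> J" for j
    using that by blast
  have all: "\<exists>q. \<forall>y \<in> insert v (terminals (J - {j}) e). \<exists>l. y = (e (j, q))(l := \<not> e (j, q) l)" if j: "j \<in> J" for j
  proof -
    obtain q where q: "\<forall>l\<in>K. (e (j, q))(l := \<not> e (j, q) l) \<in> insert v (terminals (J - {j}) e)"
      using sur[OF j] by blast
    let ?n = "\<lambda>l. (e (j, q))(l := \<not> e (j, q) l)"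
    have "inj_on ?n K"
      by (intro inj_onI) (metis fun_upd_apply)
    then have "card (?n ` K) = card K"
      by (rule card_image)
    then have "?n ` K = insert v (terminals (J - {j}) e)"
      using q card_other_terminals[OF assms(2) j, of v e] assms(2,4) by (intro card_seteq) auto
    then show ?thesis
      by blast
  qed
  obtain j j' where jj: "j \<in> J" "j' \<in> J" "j \<noteq> j'"
    using assms(3) by (metis card_2_iff' card_le_Suc0_iff_eq[OF assms(2)] not_less_eq_eq numeral_2_eq_2)
  obtain q where q: "\<forall>y \<in> insert v (terminals (J - {j}) e). \<exists>l. y = (e (j, q))(l := \<not> e (j, q) l)"
    using all[OF jj(1)] by blast
  obtain q' where q': "\<forall>y \<in> insert v (terminals (J - {j'}) e). \<exists>l. y = (e (j', q'))(l := \<not> e (j', q') l)"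
    using all[OF jj(2)] by blast
  have "e (j', q') \<in> insert v (terminals (J - {j}) e)"
    using jj by auto
  then obtain l m p where "e (j', q') = (e (j, q))(l := \<not> e (j, q) l)"
    and "v = (e (j, q))(m := \<not> e (j, q) m)" "v = (e (j', q'))(p := \<not> e (j', q') p)"
    using q q' by blast
  then show False
    using flip_common_neighbour by metis
qed

text \<open>When \<open>v\<close> and all terminals share a facet, the opposite facet is empty, and the other pairs may
  be moved there without conflict. The facet itself has \<open>card I - 1\<close> vertices to avoid, one
  more than plain connectivity permits.\<close>
lemma linkable_within_facet:
  assumes fin: "finite I" and fac: "strongly_linkable (I - {i})" and iI: "i \<in> I"
    and J: "finite J" "2 \<le> card J" "2 * card J = card I"
    and inj: "inj_on e (J \<times> UNIV)" and sub: "terminals J e \<subseteq> subcube I b - {v}"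
    and side: "\<And>x. x \<in> insert v (terminals J e) \<Longrightarrow> x i = c"
    and good: "inj_on (\<lambda>x. x(i := \<not> c)) (terminals J e)"
  shows "linkable (subcube I b - {v}) J e"
proof -
  let ?F = "subcube (I - {i}) (b(i := c))"
  have cardF: "card (I - {i}) = card I - 1"
    using iI by (simp add: card_Diff_singleton)
  have "2 * card J \<le> card (I - {i}) + 1"
    using J(3) cardF by linarith
  then obtain j where j: "j \<in> J"
    and free: "\<And>q. \<exists>l\<in>I - {i}. (e (j, q))(l := \<not> e (j, q) l) \<notin> insert v (terminals (J - {j}) e)"
    using unsurrounded_pair[OF finite_Diff[OF fin] J(1,2) _ inj] by blast
  let ?R = "insert v (terminals (J - {j}) e)"
  have stay: "(e (j, q))(i := c) = e (j, q)" for q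
    using side[of "e (j, q)"] j by auto
  have "e (j, q) \<notin> ?R" for q
    using inj sub j by (auto dest!: inj_onD)
  moreover have "e (j, q) \<in> terminals J e" for q
    using j by auto
  ultimately have ends: "e (j, q) \<in> ?F - ?R" for q
    using sub side unfolding subcube_facet[OF iI] by blast
  have "joined (?F - ?R) (e (j, False)) (e (j, True))"
  proof (rule subcube_superconnected)
    show "card ?R \<le> card (I - {i})"
      using card_other_terminals[OF J(1) j] J(3) cardF by metis
  qed (use fin J cardF ends free in auto)
  then have "joined ({x \<in> subcube I b. x i = c} - (terminals (J - {j}) e \<union> {v}))
      ((e (j, False))(i := c)) ((e (j, True))(i := c))"
    unfolding stay by (simp add: subcube_facet[OF iI])
  then show ?thesis
  proof (rule split_link[OF fac iI J(1) j _ inj sub, rotated 4])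
    show "inj_on (\<lambda>x. x(i := \<not> c)) (terminals (J - {j}) e)"
      using good by (rule inj_on_subset) auto
    show "v \<notin> (\<lambda>x. x(i := \<not> c)) ` terminals (J - {j}) e"
      using side[of v] by auto
    show "x = v" if "x \<in> {v, e (j, False), e (j, True)}" "x i \<noteq> c" for x
      using that side[of x] j by auto
  qed (use J in auto)
qed

text \<open>The pair is \<open>t\<close>, the neighbour of \<open>v\<close> in direction \<open>i\<close>, and \<open>s\<close> in the facet of \<open>v\<close>. The route runs
  from \<open>s\<close> within the facet of \<open>v\<close>, which contains no other terminal, to the neighbour of \<open>v\<close> in some
  direction \<open>m\<close>. It crosses over in direction \<open>i\<close> and reaches \<open>t\<close> in direction \<open>m\<close>. The other
  terminals are moved in direction \<open>m\<close> to the side of \<open>t\<close>, so the route takes only \<open>t\<close>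
  away from the cube of dimension \<open>card I - 2\<close> in which they are linked.\<close>
lemma linkable_by_detour:
  assumes fin: "finite I" and IH: "\<And>m. m \<in> I - {i} \<Longrightarrow> strongly_linkable (I - {i} - {m})" and iI: "i \<in> I"
    and J: "finite J" "2 \<le> card J" "2 * card J = card I" "j \<in> J"
    and inj: "inj_on e (J \<times> UNIV)" and sub: "terminals J e \<subseteq> subcube I b - {v}"
    and v: "v \<in> subcube I b"
    and t: "e (j, q) = v(i := \<not> v i)" and s: "e (j, \<not> q) i = v i"
    and others: "\<And>x. x \<in> terminals (J - {j}) e \<Longrightarrow> x i \<noteq> v i"
  shows "linkable (subcube I b - {v}) J e"
proof -
  let ?O = "terminals (J - {j}) e" and ?s = "e (j, \<not> q)"
  define u where "u = v(i := \<not> v i)"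
  have u_i: "u i = (\<not> v i)" and u_other: "\<And>k. k \<noteq> i \<Longrightarrow> u k = v k" and u_in: "u \<in> subcube I b"
    using v iI by (auto simp: u_def upd_in_subcube)
  have t': "e (j, q) = u"
    using t by (simp add: u_def)
  have cardI: "card (I - {i}) = card I - 1"
    using iI by (simp add: card_Diff_singleton)
  have "card (insert u ?O) \<le> card (I - {i})"
    using card_other_terminals[OF J(1,4)] J(3) cardI by metis
  then obtain m where m: "m \<in> I - {i}" and good: "\<And>c. inj_on (\<lambda>x. x(m := c)) (insert u ?O)"
    using collapsible_coordinate[of "insert u ?O" "I - {i}"] J cardI by auto
  have tO: "u \<notin> ?O"
    using inj J(4) unfolding t'[symmetric] by (auto dest!: inj_onD)
  have uniq: "x = u" if "x \<in> ?O" "x(m := u m) = u" for x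
    using inj_onD[OF good[of "u m"], of x u] that by simp
  let ?F = "subcube (I - {i}) (b(i := \<not> v i))"
  let ?A = "({x \<in> ?F. x m = u m} - {u}) \<union> ?O"
  have "linkable ?A (J - {j}) e"
  proof (rule linkable_facet[OF IH[OF m] m])
    show "2 * card (J - {j}) \<le> card (I - {i}) - 1"
      using J cardI by (simp add: card_Diff_singleton)
    show "inj_on e ((J - {j}) \<times> UNIV)"
      using inj by (rule inj_on_subset) auto
    show "inj_on (\<lambda>x. x(m := u m)) ?O"
      using good by (rule inj_on_subset) auto
    show "?O \<subseteq> ?F"
      using sub others by (auto simp: subcube_facet[OF iI])
    show "u \<notin> (\<lambda>x. x(m := u m)) ` ?O"
    proof
      assume "u \<in> (\<lambda>x. x(m := u m)) ` ?O"
      then obtain x where "x \<in> ?O" "u = x(m := u m)"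
        by (rule imageE)
      then show False
        using uniq[of x] tO by simp
    qed
  qed (use J in auto)
  moreover
  let ?p = "v(m := \<not> v m)"
  \<comment> \<open>The route to \<open>u\<close> passes the square spanned by \<open>v\<close>, \<open>u\<close>, \<open>?p\<close> and \<open>?p'\<close> on the side away from \<open>v\<close>.\<close>
  let ?p' = "?p(i := \<not> v i)"
  let ?G = "{x \<in> subcube I b. x i = v i} - {v}"
  let ?B = "?G \<union> {?p', u}"
  have "joined ?B (e (j, q)) ?s"
  proof (rule joined_sym)
    show "joined ?B ?s (e (j, q))"
    proof -
      have "?s \<in> ?G"
        using s sub J(4) by auto
      moreover have p: "?p \<in> ?G"
      proof -
        have "?p m \<noteq> v m"
          by simp
        then have "?p \<noteq> v"
          by metis
        then show ?thesis
          using v m by (auto intro: upd_in_subcube)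
      qed
      ultimately have "joined (subcube (I - {i}) (b(i := v i)) - {v}) ?s ?p"
        using fin J cardI by (intro subcube_connected) (auto simp: subcube_facet[OF iI])
      then have "joined ?B ?s ?p"
        by (rule joined_mono) (auto simp: subcube_facet[OF iI])
      moreover have "joined ?B ?p ?p'"
        using p by (intro joined_upd) auto
      moreover have "joined ?B ?p' u"
      proof -
        have "u = ?p'(m := v m)"
          using m by (auto simp: u_def fun_eq_iff)
        then show ?thesis
          using joined_upd[of ?p' ?B m "v m"] by simp
      qed
      ultimately show ?thesis
        unfolding t' using joined_trans by blast
    qed
  qed
  then have "joined ?B (e (j, False)) (e (j, True))"
    by (rule joined_both_orders)
  moreover have "?A \<inter> ?B = {}"
  proof -
    have "?p' \<notin> ?O"
    proof
      assume O: "?p' \<in> ?O"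
      have "?p'(m := u m) = u"
        using m by (auto simp: u_def fun_eq_iff)
      then have "?p' = u"
        using uniq[OF O] by simp
      then have "?p' m = u m"
        by simp
      then show False
        using m u_other by simp
    qed
    moreover have "?p' \<notin> {x \<in> ?F. x m = u m}"
      using m u_other by simp
    ultimately have p'A: "?p' \<notin> ?A" and uA: "u \<notin> ?A"
      using tO by blast+
    have GA: "x \<notin> ?G" if "x \<in> ?A" for x
      using that
    proof
      assume "x \<in> {x \<in> ?F. x m = u m} - {u}"
      then show ?thesis
        by (simp add: subcube_facet[OF iI])
    next
      assume "x \<in> ?O"
      then show ?thesis
        using others[of x] by blast
    qed
    show ?thesis
    proof (rule equals0I)
      fix x
      assume x: "x \<in> ?A \<inter> ?B"
      from IntD2[OF x] show False
      proof (elim UnE insertE emptyE)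
        assume "x \<in> ?G"
        then show False
          using GA[OF IntD1[OF x]] by contradiction
      qed (use IntD1[OF x] p'A uA in simp_all)
    qed
  qed
  ultimately have "linkable (?A \<union> ?B) J e"
    by (rule linkable_add_pair)
  moreover have "?A \<union> ?B \<subseteq> subcube I b - {v}"
  proof -
    have "?p' \<in> subcube I b"
      using v m iI by (auto intro!: upd_in_subcube)
    moreover have "?p' \<noteq> v"
    proof
      assume "?p' = v"
      from fun_cong[OF this, of i] show False
        by simp
    qed
    ultimately show ?thesis
      using sub u_in u_i by (auto simp: subcube_facet[OF iI])
  qed
  ultimately show ?thesis
    by (rule linkable_mono)
qed

text \<open>The case distinction on the position of the terminals relative to \<open>v\<close> along a coordinate
  in which no two terminals conflict. The only possible conflict along it is between \<open>v\<close> and the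
  terminal next to it.\<close>
lemma linkable_even:
  assumes fin: "finite I" and IH: "\<And>I'. I' \<subset> I \<Longrightarrow> strongly_linkable I'"
    and J: "finite J" "2 \<le> card J" "2 * card J = card I"
    and inj: "inj_on e (J \<times> UNIV)" and sub: "terminals J e \<subseteq> subcube I b - {v}"
    and v: "v \<in> subcube I b"
  shows "linkable (subcube I b - {v}) J e"
proof -
  let ?T = "terminals J e"
  let ?O = "\<lambda>j. terminals (J - {j}) e"
  have "card ?T \<le> card I" "0 < card I"
    using card_terminals[OF inj] J by simp_all
  then obtain i where iI: "i \<in> I" and good: "\<And>c. inj_on (\<lambda>x. x(i := c)) ?T"
    using collapsible_coordinate[of ?T I] J(1) by auto
  have fac: "strongly_linkable (I - {i})"
    using iI by (intro IH) auto
  have T_cases: "x = e (j, False) \<or> x = e (j, True) \<or> x \<in> ?O j" if x: "x \<in> ?T" for x j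
  proof -
    obtain j' q where "j' \<in> J" "x = e (j', q)"
      using x by (rule in_terminalsE)
    then show ?thesis
      by (cases "j' = j"; cases q) auto
  qed
  have notO: "e (j, q) \<notin> ?O j" if "j \<in> J" for j q
    using inj that by (auto dest!: inj_onD)
  have inT: "e (j, q) \<in> ?T" if "j \<in> J" for j q
    using that by auto
  have notv: "x \<noteq> v" if "x \<in> ?T" for x
    using that sub by auto
  have OT: "?O j \<subseteq> ?T" for j
    by auto
  have goodO: "inj_on (\<lambda>x. x(i := c)) (?O j)" for c j
    using good OT by (rule inj_on_subset)
  have collapse: "x = y" if "x \<in> ?T" "y \<in> ?T" "x(i := c) = y" for x y c
  proof -
    have "y(i := c) = y"
      unfolding that(3)[symmetric] by simp
    then show ?thesis
      using inj_onD[OF good[of c], of x y] that by simp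
  qed
  have split: "linkable (subcube I b - {v}) J e"
    if j: "j \<in> J"
      and w: "\<And>x. x \<in> {v, e (j, False), e (j, True)} \<Longrightarrow> x i \<noteq> c \<Longrightarrow> x = w"
      and w': "w \<notin> (\<lambda>x. x(i := \<not> c)) ` ?O j"
      and free: "\<And>q. (e (j, q))(i := c) \<notin> ?O j \<union> {v}"
      and away: "\<exists>x\<in>?O j \<union> {v}. x i \<noteq> c" for j c w
    by (rule split_link_connected[OF fin fac iI J(1) j J(3) inj sub goodO w w' free away])
  show ?thesis
  proof (cases "\<forall>x\<in>?T. x i = v i")
    case True
    then show ?thesis
      using linkable_within_facet[OF fin fac iI J inj sub, of "v i"] good by auto
  next
    case far: False
    \<comment> \<open>A pair inside the facet of \<open>v\<close> is routed there.\<close>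
    show ?thesis
    proof (cases "\<exists>j\<in>J. \<forall>q. e (j, q) i = v i")
      case True
      then obtain j where j: "j \<in> J" "\<And>q. e (j, q) i = v i"
        by blast
      obtain z where z: "z \<in> ?T" "z i \<noteq> v i"
        using far by blast
      then have "z \<in> ?O j"
        using T_cases[OF z(1), of j] j by auto
      moreover have stay: "(e (j, q))(i := v i) = e (j, q)" for q
        using j(2)[of q] by (simp add: fun_upd_idem)
      ultimately show ?thesis
        using j z(2) notO[OF j(1)] notv[OF inT[OF j(1)]]
        by (intro split[of j "v i" v]) auto
    next
      case split_pairs: False
      \<comment> \<open>The far end of a separated pair enters the facet of \<open>v\<close>, unless \<open>v\<close> itself is in the way.\<close>
      show ?thesis
      proof (cases "\<exists>j\<in>J. \<exists>q. e (j, q) i \<noteq> v i \<and> e (j, \<not> q) i = v i \<and> e (j, q) \<noteq> v(i := \<not> v i)")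
        case True
        then obtain j q where j: "j \<in> J" and t: "e (j, q) i \<noteq> v i" and s: "e (j, \<not> q) i = v i"
          and tv: "e (j, q) \<noteq> v(i := \<not> v i)"
          by blast
        have two: "e (j, q') = e (j, q) \<or> e (j, q') = e (j, \<not> q)" for q'
          by (cases "q' = q") auto
        have t': "(e (j, q))(i := v i) \<notin> ?T"
        proof
          assume "(e (j, q))(i := v i) \<in> ?T"
          then have "e (j, q) = (e (j, q))(i := v i)"
            using collapse[OF inT[OF j] _ HOL.refl] by blast
          from fun_cong[OF this, of i] have "e (j, q) i = v i"
            by simp
          then show False
            using t by contradiction
        qed
        have "(e (j, q))(i := v i) \<noteq> v"
          using eq_flip[of "e (j, q)" i v] tv t by blast
        moreover have s': "(e (j, \<not> q))(i := v i) = e (j, \<not> q)"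
          using s by (simp add: fun_upd_idem)
        ultimately have free: "(e (j, q'))(i := v i) \<notin> ?O j \<union> {v}" for q'
        proof -
          consider "e (j, q') = e (j, q)" | "e (j, q') = e (j, \<not> q)"
            using two by blast
          then show ?thesis
          proof cases
            case 1
            then show ?thesis
              using t' OT[of j] \<open>(e (j, q))(i := v i) \<noteq> v\<close> by auto
          next
            case 2
            then show ?thesis
              using s' notO[OF j, of "\<not> q"] notv[OF inT[OF j], of "\<not> q"] by simp
          qed
        qed
        have away: "\<exists>z\<in>?O j \<union> {v}. z i \<noteq> v i"
        proof -
          obtain j' where j': "j' \<in> J" "j' \<noteq> j"
            using J(2) by (metis card_2_iff' card_le_Suc0_iff_eq[OF J(1)] not_less_eq_eq numeral_2_eq_2)
          then obtain q' where "e (j', q') i \<noteq> v i"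
            using split_pairs by blast
          then show ?thesis
            using j' by (intro bexI[of _ "e (j', q')"]) auto
        qed
        have off: "x = e (j, q)" if "x \<in> {v, e (j, False), e (j, True)}" "x i \<noteq> v i" for x
          using that s two[of False] two[of True] by auto
        have clear: "e (j, q) \<notin> (\<lambda>x. x(i := \<not> v i)) ` ?O j"
        proof
          assume "e (j, q) \<in> (\<lambda>x. x(i := \<not> v i)) ` ?O j"
          then obtain x where "x \<in> ?O j" "e (j, q) = x(i := \<not> v i)"
            by (rule imageE)
          then show False
            using collapse[OF _ inT[OF j], of x "\<not> v i" q] OT[of j] notO[OF j, of q] by auto
        qed
        show ?thesis
          by (rule split[OF j off clear free away])
      next
        case False
        let ?t = "v(i := \<not> v i)"
        have only: "e (j, q) = ?t" if j: "j \<in> J" and s: "e (j, \<not> q) i = v i" for j q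
        proof -
          obtain q' where "e (j, q') i \<noteq> v i"
            using split_pairs j by blast
          then have "e (j, q) i \<noteq> v i"
            using s by (cases "q' = q") auto
          then show ?thesis
            using False j s by blast
        qed
        show ?thesis
        proof (cases "\<exists>j\<in>J. \<exists>q. e (j, q) i = v i")
          case True
          then obtain j q' where j: "j \<in> J" and "e (j, q') i = v i"
            by blast
          moreover define q where "q = (\<not> q')"
          ultimately have s: "e (j, \<not> q) i = v i"
            by simp
          have t: "e (j, q) = ?t"
            using j s by (rule only)
          have opposite: "x i \<noteq> v i" if xO: "x \<in> ?O j" for x
          proof
            assume "x i = v i"
            obtain j' q'' where j': "j' \<in> J - {j}" "x = e (j', q'')"
              using xO by (rule in_terminalsE)
            define q' where "q' = (\<not> q'')"
            have x: "x = e (j', \<not> q')" "j' \<in> J" "j' \<noteq> j"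
              using j' unfolding q'_def by auto
            then have "e (j', q') = e (j, q)"
              using only[of j' q'] \<open>x i = v i\<close> x t by simp
            then show False
              using inj x j by (auto dest!: inj_onD)
          qed
          have deeper: "strongly_linkable (I - {i} - {m})" if "m \<in> I - {i}" for m
            using that by (intro IH) auto
          show ?thesis
            by (rule linkable_by_detour[where j = j and q = q, OF fin _ iI J j inj sub v t s])
              (fact deeper opposite)+
        next
          case False
          \<comment> \<open>All terminals are opposite to \<open>v\<close>. Moving any other terminal than \<open>?t\<close> to the facet of \<open>v\<close>
            misses \<open>v\<close>, so \<open>?t\<close> has to belong to the pair that stays.\<close>
          obtain j where j: "j \<in> J" and tO: "?t \<notin> ?O j"
          proof (cases "?t \<in> ?T")
            case True
            then obtain j q where "j \<in> J" "?t = e (j, q)"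
              by (rule in_terminalsE)
            then show ?thesis
              using that[of j] notO[of j q] by simp
          next
            case False
            moreover obtain j where "j \<in> J"
              using J(2) by fastforce
            ultimately show ?thesis
              using that[of j] OT[of j] by blast
          qed
          have stay: "x(i := \<not> v i) = x" if "x \<in> ?T" for x
            using that False by (auto intro!: fun_upd_idem)
          have clear: "v \<notin> (\<lambda>x. x(i := \<not> \<not> v i)) ` ?O j"
          proof
            assume "v \<in> (\<lambda>x. x(i := \<not> \<not> v i)) ` ?O j"
            then obtain x where x: "x \<in> ?O j" "v = x(i := \<not> \<not> v i)"
              by (rule imageE)
            then have "x = ?t"
              using False eq_flip[of x i v] OT[of j] x by auto
            then show False
              using x tO by simp
          qed
          have off: "x = v" if "x \<in> {v, e (j, False), e (j, True)}" "x i \<noteq> (\<not> v i)" for x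
            using that False j by auto
          have free: "(e (j, q))(i := \<not> v i) \<notin> ?O j \<union> {v}" for q
            using stay[OF inT[OF j]] notO[OF j] notv[OF inT[OF j]] by simp
          have away: "\<exists>x\<in>?O j \<union> {v}. x i \<noteq> (\<not> v i)"
            by auto
          show ?thesis
            by (rule split[OF j off clear free away])
        qed
      qed
    qed
  qed
qed

text \<open>Two vertices are linked in a square by its connectivity. A cube whose dimension exceeds the number of
  terminals has a coordinate along which they and \<open>v\<close> can be collapsed. What
  remains is the tight case.\<close>
lemma strongly_linkable_finite:
  assumes "finite I"
  shows "strongly_linkable I"
  using assms
proof (induction I rule: finite_psubset_induct)
  case (psubset I)
  have core: "linkable (subcube I b - {v}) J e"
    if J: "finite J" "2 * card J \<le> card I" and inj: "inj_on e (J \<times> UNIV)"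
      and sub: "terminals J e \<subseteq> subcube I b - {v}" and v: "v \<in> subcube I b" for b J e v
  proof -
    consider (none) "J = {}" | (slack) "2 * card J < card I" | (one) j where "J = {j}" "card I = 2"
      | (even) "2 \<le> card J" "2 * card J = card I"
    proof (cases "2 * card J < card I")
      case True
      then show ?thesis
        by (rule slack)
    next
      case False
      then have full: "2 * card J = card I"
        using J(2) by linarith
      consider "card J = 0" | "card J = 1" | "2 \<le> card J"
        by linarith
      then show ?thesis
      proof cases
        case 1
        then show ?thesis
          using J(1) by (intro none) simp
      next
        case 2
        then obtain j where "J = {j}"
          by (rule card_1_singletonE)
        then show ?thesis
          using full by (intro one) auto
      next
        case 3
        then show ?thesis
          using full by (rule even)
      qed
    qed
    then show ?thesis
    proof cases
      case none
      then show ?thesis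
        by (simp add: linkable_def disjoint_family_on_def)
    next
      case slack
      have "card (insert v (terminals J e)) \<le> card I"
        using slack J card_terminals[OF inj] by (simp add: card_insert_if)
      then obtain i where i: "i \<in> I" and good: "\<And>c. inj_on (\<lambda>x. x(i := c)) (insert v (terminals J e))"
        using collapsible_coordinate[of "insert v (terminals J e)" I] J slack by auto
      let ?c = "v i"
      have "linkable (({x \<in> subcube I b. x i = ?c} - {v}) \<union> terminals J e) J e"
      proof (rule linkable_facet[OF _ i J(1) _ inj])
        show "strongly_linkable (I - {i})"
          using i psubset.IH by blast
        show "inj_on (\<lambda>x. x(i := ?c)) (terminals J e)"
          using good by (rule inj_on_subset) auto
        show "v \<notin> (\<lambda>x. x(i := v i)) ` terminals J e"
        proof
          assume "v \<in> (\<lambda>x. x(i := v i)) ` terminals J e"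
          then obtain x where "x \<in> terminals J e" "v(i := v i) = x(i := v i)"
            by auto
          then show False
            using inj_onD[OF good, of v "v i" x] sub by auto
        qed
      qed (use slack sub in auto)
      then show ?thesis
        by (rule linkable_mono) (use sub in auto)
    next
      case one
      have "joined (subcube I b - {v}) (e (j, False)) (e (j, True))"
        using sub one psubset.hyps by (intro subcube_connected) auto
      then show ?thesis
        using one by (auto simp: linkable_def disjoint_family_on_def)
    next
      case even
      then show ?thesis
        using linkable_even[OF psubset.hyps psubset.IH J(1) _ _ inj sub v] by blast
    qed
  qed
  show ?case
    unfolding strongly_linkable_def
  proof (intro allI impI, elim conjE)
    fix b J e v
    assume J: "finite J" "2 * card J \<le> card I" and inj: "inj_on e (J \<times> UNIV)"
      and sub: "terminals J e \<subseteq> subcube I b - {v}"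
    show "linkable (subcube I b - {v}) J e"
    proof (cases "v \<in> subcube I b")
      case True
      then show ?thesis
        using core J inj sub by blast
    next
      case False
      have "card (terminals J e) < card (subcube I b)"
        using J card_terminals[OF inj] less_exp[of "card I"] card_subcube[OF psubset.hyps, of b] by linarith
      moreover have "finite (terminals J e)"
        using J(1) by simp
      ultimately have "\<not> subcube I b \<subseteq> terminals J e"
        using card_mono leD by blast
      \<comment> \<open>Deleting any vertex that is not a terminal makes the task harder.\<close>
      then obtain v' where "v' \<in> subcube I b" "v' \<notin> terminals J e"
        by blast
      then have "linkable (subcube I b - {v'}) J e"
        using sub by (intro core[OF J inj]) auto
      then show ?thesis
        by (rule linkable_mono) (use False in auto)
    qed
  qed
qed

section \<open>Vertices and edges of a combinatorial cube\<close>

definition sign_vector :: "('d::finite \<Rightarrow> bool) \<Rightarrow> real ^ 'd" where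
  "sign_vector x = (\<chi> i. if x i then 1 else - 1)"

lemma sign_vector_nth [simp]: "sign_vector x $ i = (if x i then 1 else - 1)"
  by (simp add: sign_vector_def)

lemma inj_sign_vector: "inj sign_vector"
proof (rule injI)
  fix x y :: "'d::finite \<Rightarrow> bool"
  assume eq: "sign_vector x = sign_vector y"
  show "x = y"
  proof
    fix i
    have "sign_vector x $ i = sign_vector y $ i"
      using eq by simp
    then show "x i = y i"
      by (simp split: if_splits)
  qed
qed

lemma standard_cube_eq: "(standard_cube :: (real ^ 'd::finite) set) = convex hull (range sign_vector)"
proof -
  have "z \<in> range sign_vector" if "\<forall>i. z $ i = 1 \<or> z $ i = - 1" for z :: "real ^ 'd"
  proof -
    have "z = sign_vector (\<lambda>i. z $ i = 1)"
      unfolding vec_eq_iff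
    proof
      fix i
      show "z $ i = sign_vector (\<lambda>i. z $ i = 1) $ i"
        using that[rule_format, of i] by auto
    qed
    then show ?thesis
      by blast
  qed
  then have "{z :: real ^ 'd. \<forall>i. z $ i = 1 \<or> z $ i = - 1} = range sign_vector"
    by (auto split: if_splits)
  then show ?thesis
    unfolding standard_cube_def by simp
qed

lemma standard_cube_abs_le:
  assumes "z \<in> (standard_cube :: (real ^ 'd::finite) set)"
  shows "\<bar>z $ i\<bar> \<le> 1"
proof -
  let ?B = "{z :: real ^ 'd. - 1 \<le> z $ i} \<inter> {z. z $ i \<le> 1}"
  have "convex ?B"
    using convex_halfspace_ge[of "- 1" "axis i 1 :: real ^ 'd"] convex_halfspace_le[of "axis i 1 :: real ^ 'd" 1]
    by (intro convex_Int) (simp_all add: inner_axis' inner_axis)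
  moreover have "range sign_vector \<subseteq> ?B"
    by auto
  ultimately have "standard_cube \<subseteq> ?B"
    unfolding standard_cube_eq by (intro hull_minimal)
  then show ?thesis
    using assms by (auto simp: abs_le_iff)
qed

lemma sign_vector_in_standard_cube: "sign_vector x \<in> (standard_cube :: (real ^ 'd::finite) set)"
  unfolding standard_cube_eq by (intro hull_inc) simp

text \<open>Adding up the inequalities \<open>sign_vector x $ i * z $ i \<le> 1\<close> over \<open>i \<in> K\<close> gives a supporting
  hyperplane that touches the cube where all of them are tight.\<close>
lemma coordinate_face:
  fixes x :: "'d::finite \<Rightarrow> bool"
  shows "{z \<in> standard_cube. \<forall>i\<in>K. z $ i = sign_vector x $ i} face_of standard_cube"
proof -
  let ?a = "\<chi> i. if i \<in> K then sign_vector x $ i else 0"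
  have ip: "?a \<bullet> z = (\<Sum>i\<in>K. sign_vector x $ i * z $ i)" for z :: "real ^ 'd"
    by (simp add: inner_vec_def if_distrib[of "\<lambda>u. u * _"] sum.If_cases cong: if_cong)
  have le: "sign_vector x $ i * z $ i \<le> 1" if "z \<in> standard_cube" for z i
    using standard_cube_abs_le[OF that, of i] by (auto simp: abs_le_iff)
  have eq: "1 = sign_vector x $ i * z $ i \<longleftrightarrow> z $ i = sign_vector x $ i" for z :: "real ^ 'd" and i
    by auto
  have "{z \<in> standard_cube. \<forall>i\<in>K. z $ i = sign_vector x $ i} = standard_cube \<inter> {z. ?a \<bullet> z = real (card K)}"
  proof -
    have "(\<forall>i\<in>K. z $ i = sign_vector x $ i) \<longleftrightarrow> ?a \<bullet> z = real (card K)" if z: "z \<in> standard_cube" for z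
    proof -
      have "?a \<bullet> z = real (card K) \<longleftrightarrow> (\<Sum>i\<in>K. 1 - sign_vector x $ i * z $ i) = 0"
        unfolding ip by (auto simp: sum_subtractf)
      also have "\<dots> \<longleftrightarrow> (\<forall>i\<in>K. 1 - sign_vector x $ i * z $ i = 0)"
        using le[OF z] by (intro sum_nonneg_eq_0_iff) auto
      finally show ?thesis
        by (simp only: right_minus_eq eq)
    qed
    then show ?thesis
      by blast
  qed
  moreover have "?a \<bullet> z \<le> real (card K)" if "z \<in> standard_cube" for z
    unfolding ip using sum_mono[of K "\<lambda>i. sign_vector x $ i * z $ i" "\<lambda>_. 1"] le[OF that] by simp
  ultimately show ?thesis
    unfolding standard_cube_eq by (simp add: face_of_Int_supporting_hyperplane_le)
qed

lemma extreme_point_standard_cube: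
  "z extreme_point_of (standard_cube :: (real ^ 'd::finite) set) \<longleftrightarrow> z \<in> range sign_vector"
proof
  assume "z extreme_point_of (standard_cube :: (real ^ 'd::finite) set)"
  then show "z \<in> range sign_vector"
    unfolding standard_cube_eq by (rule extreme_point_of_convex_hull)
next
  assume "z \<in> range sign_vector"
  then obtain x where z: "z = sign_vector x"
    by blast
  have "{y \<in> standard_cube. \<forall>i\<in>UNIV. y $ i = sign_vector x $ i} = {z}"
    unfolding z using sign_vector_in_standard_cube by (auto simp: vec_eq_iff)
  then show "z extreme_point_of standard_cube"
    using coordinate_face[of UNIV x] by (simp flip: face_of_singleton)
qed

text \<open>The edges of the standard cube enter only through the vertices they contain, because
  this is what an isomorphism of face lattices preserves.\<close>
lemma edge_face_of_standard_cube:
  fixes x :: "'d::finite \<Rightarrow> bool"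
  shows "\<exists>F. F face_of standard_cube \<and> (\<forall>y. sign_vector y \<in> F \<longleftrightarrow> y = x \<or> y = x(i := \<not> x i))"
proof (intro exI conjI allI)
  let ?F = "{z \<in> standard_cube. \<forall>l\<in>- {i}. z $ l = sign_vector x $ l}"
  show "?F face_of standard_cube"
    by (rule coordinate_face)
  fix y :: "'d \<Rightarrow> bool"
  have "sign_vector y \<in> ?F \<longleftrightarrow> (\<forall>l. l \<noteq> i \<longrightarrow> y l = x l)"
    by (auto simp: sign_vector_in_standard_cube)
  also have "\<dots> \<longleftrightarrow> y = x \<or> y = x(i := \<not> x i)"
    by (auto simp: fun_eq_iff)
  finally show "sign_vector y \<in> ?F \<longleftrightarrow> y = x \<or> y = x(i := \<not> x i)" .
qed

text \<open>Vertices are the minimal nonempty faces: the image of a vertex is a nonempty compact convex face, so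
  it contains a vertex \<open>x\<close>, and the face that corresponds to \<open>x\<close> lies below the given vertex.\<close>
lemma face_iso_vertex:
  fixes P :: "'a::euclidean_space set" and Q :: "'b::euclidean_space set"
  assumes Q: "compact Q" "convex Q"
    and mono: "\<And>F G. F face_of P \<Longrightarrow> G face_of P \<Longrightarrow> F \<subseteq> G \<longleftrightarrow> \<phi> F \<subseteq> \<phi> G"
    and bij: "bij_betw \<phi> {F. F face_of P} {F. F face_of Q}"
    and u: "u extreme_point_of P"
  obtains x where "x extreme_point_of Q" "\<phi> {u} = {x}"
proof -
  have face: "\<phi> F face_of Q" if "F face_of P" for F
    using bij that by (auto simp: bij_betw_def)
  have u': "{u} face_of P"
    using u by (simp add: face_of_singleton)
  \<comment> \<open>The isomorphism maps the empty face to the empty face, since \<open>E\<close> has to be the least face.\<close>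
  obtain E where E: "E face_of P" "\<phi> E = {}"
    using bij by (metis (mono_tags, lifting) bij_betw_imp_surj_on empty_face_of imageE mem_Collect_eq)
  have "\<phi> {u} \<noteq> {}"
    using mono[OF u' E(1)] mono[OF u' empty_face_of] mono[OF E(1) empty_face_of] E(2) by auto
  moreover have "compact (\<phi> {u})" "convex (\<phi> {u})"
    using face[OF u'] Q face_of_imp_compact face_of_imp_convex by blast+
  ultimately obtain x where x: "x extreme_point_of \<phi> {u}"
    using extreme_point_exists_convex by blast
  then have x': "x extreme_point_of Q" "x \<in> \<phi> {u}"
    using extreme_point_of_face[OF face[OF u']] by auto
  then obtain F where F: "F face_of P" "\<phi> F = {x}"
    using bij by (metis (mono_tags, lifting) bij_betw_imp_surj_on face_of_singleton imageE mem_Collect_eq)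
  then have "F \<subseteq> {u}"
    using mono[OF F(1) u'] x' by simp
  moreover have "F \<noteq> {}"
    using mono[OF F(1) E(1)] E(2) F(2) by auto
  ultimately have "F = {u}"
    by auto
  then show ?thesis
    using that x'(1) F(2) by blast
qed

text \<open>The face of \<open>P\<close> that corresponds to an edge of the cube has exactly two vertices. By the
  Krein-Milman theorem it is their convex hull, a segment.\<close>
lemma is_cube_vertices:
  fixes P :: "'a::euclidean_space set"
  assumes "is_cube TYPE('d::finite) P"
  obtains g :: "('d::finite \<Rightarrow> bool) \<Rightarrow> 'a" where "bij_betw g UNIV {v. v extreme_point_of P}"
    "\<And>x i. closed_segment (g x) (g (x(i := \<not> x i))) edge_of P"
proof -
  let ?Q = "standard_cube :: (real ^ 'd) set"
  have P: "compact P" "convex P"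
    using assms polytope_imp_compact polytope_imp_convex by (auto simp: is_cube_def)
  have Q: "compact ?Q" "convex ?Q"
    unfolding standard_cube_eq by (simp_all add: finite_imp_compact_convex_hull)
  obtain \<phi> where bij: "bij_betw \<phi> {F. F face_of P} {F. F face_of ?Q}"
    and mono: "\<And>F G. F face_of P \<Longrightarrow> G face_of P \<Longrightarrow> F \<subseteq> G \<longleftrightarrow> \<phi> F \<subseteq> \<phi> G"
    using assms unfolding is_cube_def combinatorially_equivalent_def by blast
  define \<psi> where "\<psi> = inv_into {F. F face_of P} \<phi>"
  have bij': "bij_betw \<psi> {F. F face_of ?Q} {F. F face_of P}"
    unfolding \<psi>_def using bij by (rule bij_betw_inv_into)
  have \<phi>\<psi>: "\<phi> (\<psi> F) = F" if "F face_of ?Q" for F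
    unfolding \<psi>_def using bij that by (simp add: bij_betw_inv_into_right)
  have \<psi>\<phi>: "\<psi> (\<phi> F) = F" if "F face_of P" for F
    unfolding \<psi>_def using bij that by (simp add: bij_betw_inv_into_left)
  have \<psi>_face: "\<psi> F face_of P" if "F face_of ?Q" for F
    using bij' that by (auto simp: bij_betw_def)
  have mono': "F \<subseteq> G \<longleftrightarrow> \<psi> F \<subseteq> \<psi> G" if "F face_of ?Q" "G face_of ?Q" for F G
    using mono[OF \<psi>_face \<psi>_face] \<phi>\<psi> that by simp
  have "\<exists>u. u extreme_point_of P \<and> \<psi> {sign_vector x} = {u}" for x
  proof -
    have "sign_vector x extreme_point_of ?Q"
      by (simp add: extreme_point_standard_cube)
    from face_iso_vertex[where \<phi> = \<psi>, OF P mono' bij' this]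
    obtain u where "u extreme_point_of P" "\<psi> {sign_vector x} = {u}"
      by metis
    then show ?thesis
      by blast
  qed
  then obtain g where g: "\<And>x. g x extreme_point_of P" "\<And>x. \<psi> {sign_vector x} = {g x}"
    by metis
  have sv: "{sign_vector x} face_of ?Q" for x
    by (simp add: face_of_singleton extreme_point_standard_cube)
  have inj: "inj g"
  proof (rule injI)
    fix x y
    assume "g x = g y"
    then have "\<psi> {sign_vector x} = \<psi> {sign_vector y}"
      using g by simp
    then have "{sign_vector x} = {sign_vector y}"
      using \<phi>\<psi>[OF sv] by metis
    then show "x = y"
      by (simp add: inj_eq[OF inj_sign_vector])
  qed
  have surj: "\<exists>x. u = g x" if u: "u extreme_point_of P" for u
  proof -
    from face_iso_vertex[where \<phi> = \<phi>, OF Q mono bij u]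
    obtain z where z: "z extreme_point_of ?Q" "\<phi> {u} = {z}"
      by metis
    from z(1) obtain x where "z = sign_vector x"
      unfolding extreme_point_standard_cube by (rule imageE)
    with z(2) have x: "\<phi> {u} = {sign_vector x}"
      by simp
    have "{u} face_of P"
      using u by (simp add: face_of_singleton)
    from \<psi>\<phi>[OF this] have "{u} = {g x}"
      unfolding x g(2) by simp
    then show ?thesis
      by blast
  qed
  have "closed_segment (g x) (g (x(i := \<not> x i))) edge_of P" for x i
  proof -
    let ?y = "x(i := \<not> x i)"
    obtain F where F: "F face_of ?Q" "\<And>z. sign_vector z \<in> F \<longleftrightarrow> z = x \<or> z = ?y"
      using edge_face_of_standard_cube[of x i] by blast
    have mem: "g z \<in> \<psi> F \<longleftrightarrow> z = x \<or> z = ?y" for z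
      using mono'[OF sv F(1), of z] F(2)[of z] g(2)[of z] by simp
    have ext: "{u. u extreme_point_of \<psi> F} = {g x, g ?y}"
    proof -
      have "u extreme_point_of \<psi> F \<longleftrightarrow> u = g x \<or> u = g ?y" for u
        unfolding extreme_point_of_face[OF \<psi>_face[OF F(1)]] using mem g(1) surj by metis
      then show ?thesis
        by blast
    qed
    have "compact (\<psi> F)" "convex (\<psi> F)"
      using \<psi>_face[OF F(1)] P face_of_imp_compact face_of_imp_convex by blast+
    then have "\<psi> F = closed_segment (g x) (g ?y)"
      using Krein_Milman_Minkowski[of "\<psi> F"] unfolding ext segment_convex_hull by blast
    moreover have "aff_dim (closed_segment (g x) (g ?y)) = 1"
    proof -
      have "x \<noteq> ?y"
        by (metis fun_upd_same)
      then have "g x \<noteq> g ?y"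
        using inj by (simp add: inj_eq)
      then show ?thesis
        by (simp add: segment_convex_hull aff_dim_convex_hull aff_dim_2)
    qed
    ultimately show ?thesis
      using \<psi>_face[OF F(1)] by (simp add: edge_of_def)
  qed
  moreover have "bij_betw g UNIV {v. v extreme_point_of P}"
    using inj surj g(1) unfolding bij_betw_def by auto
  ultimately show ?thesis
    using that by blast
qed

section \<open>Strong linkedness of cube graphs\<close>

lemma vpath_of_joined:
  assumes "joined W x y" and W: "g ` W \<subseteq> verts G"
    and arc: "\<And>x i. x \<in> W \<Longrightarrow> x(i := \<not> x i) \<in> W \<Longrightarrow> (g x, g (x(i := \<not> x i))) \<in> arcs_ends G"
  obtains p where "vpath p G" "hd p = g x" "last p = g y" "set p \<subseteq> g ` W"
proof -
  have "\<exists>p. vwalk p G \<and> hd p = g x \<and> last p = g y \<and> set p \<subseteq> g ` W"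
    using assms(1)
  proof (induction rule: joined.induct)
    case (stay x)
    then show ?case
      using W by (intro exI[of _ "[g x]"]) (auto simp: vwalk_def)
  next
    case (move x i c y)
    then obtain p where p: "vwalk p G" "hd p = g (x(i := c))" "last p = g y" "set p \<subseteq> g ` W"
      by blast
    consider "x(i := c) = x" | "x(i := c) = x(i := \<not> x i)"
      using upd_eq_cases by metis
    then show ?case
    proof cases
      case 1
      then show ?thesis
        using p by (intro exI[of _ p]) simp
    next
      case 2
      then have "(g x, hd p) \<in> arcs_ends G"
        using arc[OF move(1), of i] p(2) joined_in[OF move(2)] by simp
      then have "vwalk (g x # p) G"
        using p(1) W move(1) by (intro vwalk_consI) auto
      moreover have "p \<noteq> []"
        using p(1) by (auto simp: vwalk_def)
      ultimately show ?thesis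
        using p move(1) by (intro exI[of _ "g x # p"]) auto
    qed
  qed
  then obtain p where p: "vwalk p G" "hd p = g x" "last p = g y" "set p \<subseteq> g ` W"
    by blast
  have "vpath (vwalk_to_vpath p) G"
    using p(1) by (rule vwalk_to_vpath_vpath)
  moreover have "set (vwalk_to_vpath p) \<subseteq> g ` W"
    using p(4) by (auto dest: vwalk_to_vpath_subset)
  ultimately show ?thesis
    using p(2,3) that by (simp add: vwalk_to_vpath_hd vwalk_to_vpath_last)
qed

theorem theorem25:
  fixes P :: "'a::euclidean_space set"
  assumes "is_cube TYPE('d::finite) P"
  shows "strongly_linked (CARD('d) div 2) (polytope_graph P)"
proof -
  let ?G = "polytope_graph P" and ?k = "CARD('d) div 2"
  obtain g :: "('d \<Rightarrow> bool) \<Rightarrow> 'a" where g: "bij_betw g UNIV {v. v extreme_point_of P}"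
    and edge: "\<And>x i. closed_segment (g x) (g (x(i := \<not> x i))) edge_of P"
    using is_cube_vertices[OF assms] by blast
  have verts: "verts ?G = range g"
    using g by (simp add: polytope_graph_def bij_betw_def)
  have inj: "inj g"
    using g by (simp add: bij_betw_def)
  have ext: "g x extreme_point_of P" for x
    using g by (auto simp: bij_betw_def)
  have "card (verts ?G) = 2 ^ CARD('d)"
    unfolding verts using inj by (simp add: card_image card_fun)
  then have card: "2 * ?k + 1 \<le> card (verts ?G)"
    using less_exp[of "CARD('d)"] by linarith
  have "linked ?k (pre_digraph.del_vert ?G v)" if v: "v \<in> verts ?G" for v
  proof -
    let ?H = "pre_digraph.del_vert ?G v"
    obtain v' where v': "v = g v'"
      using v unfolding verts by (rule rangeE)
    have vH: "verts ?H = g ` (- {v'})"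
      unfolding pre_digraph.verts_del_vert verts v' using image_set_diff[OF inj, of UNIV "{v'}"] by (simp add: Compl_eq_Diff_UNIV)
    have arc: "(g x, g (x(i := \<not> x i))) \<in> arcs_ends ?H" if "x \<noteq> v'" "x(i := \<not> x i) \<noteq> v'" for x i
    proof -
      have "(g x, g (x(i := \<not> x i))) \<in> arcs ?H"
        using that ext edge inj by (simp add: pre_digraph.arcs_del_vert v' polytope_graph_def inj_eq)
      moreover have "arc_to_ends ?H (g x, g (x(i := \<not> x i))) = (g x, g (x(i := \<not> x i)))"
        by (simp add: arc_to_ends_def pre_digraph.tail_del_vert pre_digraph.head_del_vert polytope_graph_def)
      ultimately show ?thesis
        unfolding arcs_ends_def by force
    qed
    have paths: "\<exists>L. (\<forall>i<?k. vpath (L i) ?H \<and> hd (L i) = s i \<and> last (L i) = t i) \<and>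
        (\<forall>i<?k. \<forall>j<?k. i \<noteq> j \<longrightarrow> set (L i) \<inter> set (L j) = {})"
      if sub: "s ` {..<?k} \<union> t ` {..<?k} \<subseteq> verts ?H"
        and dist: "card (s ` {..<?k} \<union> t ` {..<?k}) = 2 * ?k" for s t :: "nat \<Rightarrow> 'a"
    proof -
      define e where "e q = inv g (if snd q then t (fst q) else s (fst q))" for q
      have ge: "g (e q) = (if snd q then t (fst q) else s (fst q))" if "q \<in> {..<?k} \<times> UNIV" for q
      proof -
        have "(if snd q then t (fst q) else s (fst q)) \<in> range g"
          using sub that unfolding vH by (cases q) auto
        then show ?thesis
          unfolding e_def by (rule f_inv_into_f)
      qed
      have im: "(\<lambda>q. g (e q)) ` ({..<?k} \<times> UNIV) = s ` {..<?k} \<union> t ` {..<?k}"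
      proof -
        have "(\<lambda>q. g (e q)) ` ({..<?k} \<times> UNIV) =
            (\<lambda>q. if snd q then t (fst q) else s (fst q)) ` ({..<?k} \<times> UNIV)"
          using ge by (rule image_cong[OF HOL.refl])
        also have "\<dots> = s ` {..<?k} \<union> t ` {..<?k}"
          by (force simp: image_iff UNIV_bool)
        finally show ?thesis .
      qed
      have "inj_on (\<lambda>q. g (e q)) ({..<?k} \<times> UNIV)"
        using im dist by (intro eq_card_imp_inj_on) (auto simp: card_cartesian_product)
      then have inj_e: "inj_on e ({..<?k} \<times> UNIV)"
        by (intro inj_on_imageI2[of g e]) (simp add: comp_def)
      have UN: "subcube UNIV v' = UNIV"
        by (simp add: subcube_def)
      have "g ` terminals {..<?k} e \<subseteq> g ` (- {v'})"
        using im sub unfolding image_image vH by simp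
      then have "terminals {..<?k} e \<subseteq> subcube UNIV v' - {v'}"
        using inj unfolding UN by (simp add: inj_image_subset_iff Compl_eq_Diff_UNIV)
      moreover have "strongly_linkable (UNIV :: 'd set)"
        by (rule strongly_linkable_finite) simp
      ultimately have "linkable (subcube UNIV v' - {v'}) {..<?k} e"
        using inj_e unfolding strongly_linkable_def by auto
      then obtain W where W: "\<And>j. j < ?k \<Longrightarrow> W j \<subseteq> - {v'}"
        and jn: "\<And>j. j < ?k \<Longrightarrow> joined (W j) (e (j, False)) (e (j, True))"
        and dis: "disjoint_family_on W {..<?k}"
        unfolding linkable_def UN by auto
      have "\<exists>p. vpath p ?H \<and> hd p = s j \<and> last p = t j \<and> set p \<subseteq> g ` W j" if j: "j < ?k" for j
      proof -
        obtain p where "vpath p ?H" "hd p = g (e (j, False))" "last p = g (e (j, True))" "set p \<subseteq> g ` W j"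
        proof (rule vpath_of_joined[OF jn[OF j], of g ?H])
          show "g ` W j \<subseteq> verts ?H"
            using W[OF j] by (auto simp: vH)
          show "(g x, g (x(i := \<not> x i))) \<in> arcs_ends ?H" if "x \<in> W j" "x(i := \<not> x i) \<in> W j" for x i
            using that W[OF j] by (intro arc) auto
        qed
        then show ?thesis
          using ge[of "(j, False)"] ge[of "(j, True)"] j by auto
      qed
      then obtain L where L: "\<And>j. j < ?k \<Longrightarrow> vpath (L j) ?H \<and> hd (L j) = s j \<and> last (L j) = t j \<and> set (L j) \<subseteq> g ` W j"
        by metis
      have "set (L i) \<inter> set (L j) = {}" if "i < ?k" "j < ?k" "i \<noteq> j" for i j
      proof -
        have "W i \<inter> W j = {}"
          using dis that by (auto simp: disjoint_family_on_def)
        then have "g ` W i \<inter> g ` W j = {}"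
          using inj by (simp flip: image_Int)
        then show ?thesis
          using L[OF that(1)] L[OF that(2)] by blast
      qed
      then show ?thesis
        using L by (intro exI[of _ L]) simp
    qed
    moreover have "2 * ?k \<le> card (verts ?H)"
      using card v by (simp add: pre_digraph.verts_del_vert)
    ultimately show ?thesis
      unfolding linked_def by blast
  qed
  then show ?thesis
    using card unfolding strongly_linked_def by blast
qed

end
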